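(* Let $n$ be an even positive integer and let $S$ be an $n\times n$ Seidel matrix of a tournament. Then either $S$ is a skew-conference matrix or \[\det S\le (n-1)^{\frac{n-2}{2}}\sqrt{(n-1)^2-4}.\]
   Context: A tournament of order $n$ is a digraph on $\{1,\dots,n\}$ with exactly one of the arcs $ij$, $ji$ for each pair $i\ne j$. Its Seidel matrix $S=[s_{ij}]$ is the $n\times n$ skew-symmetric matrix with zero diagonal, $s_{ij}=1$ if $ij$ is an arc and $s_{ij}=-1$ otherwise. A skew-conference matrix of order $n$ is an $n\times n$ skew-symmetric matrix $C$ with entries in $\{0,\pm1\}$ such that $CC^\top=(n-1)I$. *)

theory Defs
  imports Complex_Main "Graph_Theory.Pair_Digraph" "Jordan_Normal_Form.Determinant"
begin

definition tournament :: "nat \<Rightarrow> nat pair_pre_digraph \<Rightarrow> bool" where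
  "tournament n T \<longleftrightarrow> pair_digraph T \<and> pverts T = {1..n} \<and>
     (\<forall>i\<in>{1..n}. \<forall>j\<in>{1..n}. i \<noteq> j \<longrightarrow>
        ((i, j) \<in> parcs T \<and> (j, i) \<notin> parcs T) \<or> ((j, i) \<in> parcs T \<and> (i, j) \<notin> parcs T))"

text \<open>Matrix indices start at 0 and vertices at 1, so row (column) \<open>i\<close> belongs to vertex \<open>i + 1\<close>.\<close>

definition seidel_matrix :: "nat \<Rightarrow> nat pair_pre_digraph \<Rightarrow> real mat" where
  "seidel_matrix n T = mat n n (\<lambda>(i, j).
     if i = j then 0 else if (i + 1, j + 1) \<in> parcs T then 1 else - 1)"

definition skew_symmetric_mat :: "real mat \<Rightarrow> bool" where
  "skew_symmetric_mat A \<longleftrightarrow> transpose_mat A = - A"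

definition skew_conference_matrix :: "nat \<Rightarrow> real mat \<Rightarrow> bool" where
  "skew_conference_matrix n C \<longleftrightarrow> C \<in> carrier_mat n n \<and> skew_symmetric_mat C \<and>
     elements_mat C \<subseteq> {0, 1, - 1} \<and> C * transpose_mat C = (real n - 1) \<cdot>\<^sub>m 1\<^sub>m n"

lemma skew_symmetric_seidel_matrix:
  assumes "tournament n T"
  shows "skew_symmetric_mat (seidel_matrix n T)"
proof -
  have anti: "seidel_matrix n T $$ (j, i) = - seidel_matrix n T $$ (i, j)"
    if "i < n" "j < n" for i j
  proof (cases "i = j")
    case True
    then show ?thesis using that by (simp add: seidel_matrix_def)
  next
    case False
    have "i + 1 \<in> {1..n}" "j + 1 \<in> {1..n}" "i + 1 \<noteq> j + 1"
      using that False by auto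
    then have "((i + 1, j + 1) \<in> parcs T \<and> (j + 1, i + 1) \<notin> parcs T) \<or>
        ((j + 1, i + 1) \<in> parcs T \<and> (i + 1, j + 1) \<notin> parcs T)"
      using assms unfolding tournament_def by blast
    then show ?thesis using that False by (auto simp: seidel_matrix_def)
  qed
  have dim: "dim_row (seidel_matrix n T) = n" "dim_col (seidel_matrix n T) = n"
    by (simp_all add: seidel_matrix_def)
  show ?thesis
    unfolding skew_symmetric_mat_def
  proof (rule eq_matI)
    fix i j
    assume "i < dim_row (- seidel_matrix n T)" "j < dim_col (- seidel_matrix n T)"
    then have ij: "i < n" "j < n" by (simp_all add: dim)
    show "transpose_mat (seidel_matrix n T) $$ (i, j) = (- seidel_matrix n T) $$ (i, j)"
      using anti[OF ij] ij by (simp add: dim)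
  qed (simp_all add: dim)
qed

end

(* By Hadamard's inequality applied after subtracting from row j of S its projection to row i,
   det(S)^2 is at most (n-1)^(n-2) * ((n-1)^2 - g^2), where g is the inner product of rows i and j.
   For i \<noteq> j, g is a sum of n - 2 signs, so it is even; unless S is a skew-conference matrix,
   some such g is nonzero and then g^2 \<ge> 4. *)
theory Submission
  imports Defs
begin

lemma row_addrow:
  assumes "A \<in> carrier_mat n m" "k < n" "l < n" "i < n"
  shows "row (addrow a k l A) i = (if i = k then a \<cdot>\<^sub>v row A l + row A k else row A i)"
  using assms by (intro eq_vecI) auto

text \<open>A sum of real squares vanishes only if every entry does. This settles the cases below
  where a projection onto a zero row divides by 0.\<close>

lemma scalar_prod_self_eq_0_imp:
  fixes v w :: "real vec"
  assumes "v \<in> carrier_vec n" "w \<in> carrier_vec n" "v \<bullet> v = 0"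
  shows "w \<bullet> v = 0"
proof -
  have "(\<Sum>k\<in>{0..<n}. v $ k * v $ k) = 0"
    using assms by (simp add: scalar_prod_def)
  then have "v $ k = 0" if "k < n" for k
    using that by (subst (asm) sum_nonneg_eq_0_iff) auto
  then show ?thesis
    using assms by (simp add: scalar_prod_def)
qed

text \<open>One Gram-Schmidt step without normalization, realized by \<open>addrow\<close>, which
  preserves \<open>det\<close>. The fifth property lets steps be chained: subtracting a multiple of
  row \<open>i\<close> does not disturb inner products with rows orthogonal to row \<open>i\<close>.
  If row \<open>i\<close> is zero, division by 0 yields 0 and all claims still hold.\<close>

lemma subtract_row_projection:
  fixes A :: "real mat"
  assumes A: "A \<in> carrier_mat n n" and i: "i < n" and j: "j < n" and ij: "i \<noteq> j"
  obtains B where "B \<in> carrier_mat n n" "det B = det A"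
    "\<And>k. k < n \<Longrightarrow> k \<noteq> j \<Longrightarrow> row B k = row A k"
    "row B j \<bullet> row A i = 0"
    "\<And>k. k < n \<Longrightarrow> row A i \<bullet> row A k = 0 \<Longrightarrow> row B j \<bullet> row A k = row A j \<bullet> row A k"
    "row B j \<bullet> row B j = row A j \<bullet> row A j - (row A j \<bullet> row A i)\<^sup>2 / (row A i \<bullet> row A i)"
proof
  define c where "c = - (row A j \<bullet> row A i) / (row A i \<bullet> row A i)"
  let ?B = "addrow c j i A"
  have car[simp]: "row A k \<in> carrier_vec n" for k
    using A by (metis carrier_matD(2) row_carrier)
  have Bj: "row ?B j = c \<cdot>\<^sub>v row A i + row A j"
    using row_addrow[OF A j i j] by simp
  have prod: "row ?B j \<bullet> w = c * (row A i \<bullet> w) + row A j \<bullet> w" if "w \<in> carrier_vec n" for w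
    unfolding Bj using that by (subst add_scalar_prod_distrib[of _ n]) (auto simp: smult_scalar_prod_distrib[of _ n])
  have degenerate: "row A j \<bullet> row A i = 0" if "row A i \<bullet> row A i = 0"
    using that scalar_prod_self_eq_0_imp[of "row A i" n "row A j"] by simp
  have comm: "row A i \<bullet> row A j = row A j \<bullet> row A i"
    by (rule comm_scalar_prod[of _ n]) auto
  show "?B \<in> carrier_mat n n" using A by simp
  show "det ?B = det A" using det_addrow[OF i _ A] ij by metis
  show "row ?B k = row A k" if "k < n" "k \<noteq> j" for k
    using row_addrow[OF A j i that(1)] that by simp
  show orth: "row ?B j \<bullet> row A i = 0"
    using degenerate unfolding prod[OF car]
    by (cases "row A i \<bullet> row A i = 0") (simp_all add: c_def)
  show "row ?B j \<bullet> row A k = row A j \<bullet> row A k" if "k < n" "row A i \<bullet> row A k = 0" for k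
    using that by (simp add: prod)
  \<comment> \<open>Only the right factor is split, so \<open>orth\<close> removes the first term
    and no expression quadratic in \<open>c\<close> arises.\<close>
  have "row ?B j \<bullet> row ?B j = c * (row ?B j \<bullet> row A i) + row ?B j \<bullet> row A j"
    by (subst (2) Bj, subst scalar_prod_add_distrib[of _ n]) (auto simp: Bj)
  also have "\<dots> = c * (row A j \<bullet> row A i) + row A j \<bullet> row A j"
    using orth by (simp add: prod comm)
  finally show "row ?B j \<bullet> row ?B j = row A j \<bullet> row A j - (row A j \<bullet> row A i)\<^sup>2 / (row A i \<bullet> row A i)"
    by (simp add: c_def power2_eq_square)
qed

lemma scalar_prod_self_nonneg: "(v :: real vec) \<bullet> v \<ge> 0"
  by (simp add: scalar_prod_def sum_nonneg)

text \<open>Induction on \<open>m\<close>: the projections of row \<open>k\<close> onto the rows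
  before it are subtracted one at a time. Those rows stay fixed and are mutually orthogonal, so each
  subtraction keeps the zeros already obtained, and it can only shorten row
  \<open>k\<close>.\<close>

lemma orthogonalize_row:
  fixes A :: "real mat"
  assumes A: "A \<in> carrier_mat n n" and k: "k < n"
    and orth: "\<And>i j. i < k \<Longrightarrow> j < i \<Longrightarrow> row A i \<bullet> row A j = 0"
  shows "m \<le> k \<Longrightarrow> \<exists>B \<in> carrier_mat n n. det B = det A
    \<and> (\<forall>i<n. i \<noteq> k \<longrightarrow> row B i = row A i)
    \<and> row B k \<bullet> row B k \<le> row A k \<bullet> row A k \<and> (\<forall>j<m. row B k \<bullet> row B j = 0)"
proof (induction m)
  case 0
  then show ?case using A by auto
next
  case (Suc m)
  then obtain B where B: "B \<in> carrier_mat n n" "det B = det A"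
    "\<forall>i<n. i \<noteq> k \<longrightarrow> row B i = row A i" "row B k \<bullet> row B k \<le> row A k \<bullet> row A k"
    "\<forall>j<m. row B k \<bullet> row B j = 0" by auto
  have mk: "m < n" "m \<noteq> k" "m < k" using Suc k by auto
  obtain C where C: "C \<in> carrier_mat n n" "det C = det B"
    "\<And>l. l < n \<Longrightarrow> l \<noteq> k \<Longrightarrow> row C l = row B l"
    "row C k \<bullet> row B m = 0"
    "\<And>l. l < n \<Longrightarrow> row B m \<bullet> row B l = 0 \<Longrightarrow> row C k \<bullet> row B l = row B k \<bullet> row B l"
    "row C k \<bullet> row C k = row B k \<bullet> row B k - (row B k \<bullet> row B m)\<^sup>2 / (row B m \<bullet> row B m)"
    using subtract_row_projection[OF B(1) mk(1) k mk(2)] by blast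
  have "row C k \<bullet> row C k \<le> row A k \<bullet> row A k"
    using C(6) B(4) divide_nonneg_nonneg[OF zero_le_power2 scalar_prod_self_nonneg,
        of "row B k \<bullet> row B m" "row B m"] by linarith
  moreover have "row C k \<bullet> row C j = 0" if j: "j < Suc m" for j
  proof (cases "j = m")
    case True
    then show ?thesis using C(3,4) mk by simp
  next
    case False
    then have jm: "j < m" using j by simp
    \<comment> \<open>Rows \<open>m\<close> and \<open>j\<close> are still rows of \<open>A\<close>,
      so \<open>orth\<close> applies; hence removing the component along row \<open>m\<close> keeps
      row \<open>k\<close> orthogonal to row \<open>j\<close>.\<close>
    have "row B m \<bullet> row B j = 0"
      using B(3) mk jm orth[of m j] by simp
    then show ?thesis using C(3)[of j] C(5)[of j] B(5) mk jm by simp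
  qed
  ultimately show ?case using C B by auto
qed

text \<open>Gram-Schmidt over all rows: \<open>k\<close> counts the leading rows already mutually
  orthogonal, and each step changes row \<open>k\<close> alone.\<close>

lemma orthogonalize_rows:
  fixes A :: "real mat"
  assumes A: "A \<in> carrier_mat n n"
  shows "k \<le> n \<Longrightarrow> \<exists>B \<in> carrier_mat n n. det B = det A
    \<and> (\<forall>i<n. row B i \<bullet> row B i \<le> row A i \<bullet> row A i)
    \<and> (\<forall>i<k. \<forall>j<i. row B i \<bullet> row B j = 0)"
proof (induction k)
  case 0
  then show ?case using A by auto
next
  case (Suc k)
  then obtain B where B: "B \<in> carrier_mat n n" "det B = det A"
    "\<forall>i<n. row B i \<bullet> row B i \<le> row A i \<bullet> row A i"
    "\<forall>i<k. \<forall>j<i. row B i \<bullet> row B j = 0" by auto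
  have k: "k < n" using Suc by simp
  obtain C where C: "C \<in> carrier_mat n n" "det C = det B"
    "\<forall>i<n. i \<noteq> k \<longrightarrow> row C i = row B i"
    "row C k \<bullet> row C k \<le> row B k \<bullet> row B k" "\<forall>j<k. row C k \<bullet> row C j = 0"
    using orthogonalize_row[OF B(1) k, of k] B(4) by auto
  have "row C i \<bullet> row C i \<le> row A i \<bullet> row A i" if "i < n" for i
    using C(3,4) B(3) that by (cases "i = k") (auto intro: order_trans)
  moreover have "row C i \<bullet> row C j = 0" if "i < Suc k" "j < i" for i j
    using that C(3,5) B(4) k by (cases "i = k") auto
  ultimately show ?case using C(1,2) B(2) by auto
qed

lemma mult_transpose_index:
  assumes "A \<in> carrier_mat n m" "i < n" "j < n"
  shows "(A * transpose_mat A) $$ (i, j) = row A i \<bullet> row A j"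
  using assms by simp

text \<open>After orthogonalization the determinant of the Gram matrix is the product of the squared
  row lengths. It also equals the square of \<open>det A\<close>, and no row has become
  longer.\<close>

lemma Hadamard_inequality:
  fixes A :: "real mat"
  assumes A: "A \<in> carrier_mat n n"
  shows "(det A)\<^sup>2 \<le> (\<Prod>i<n. row A i \<bullet> row A i)"
proof -
  obtain B where B: "B \<in> carrier_mat n n" "det B = det A"
    "\<forall>i<n. row B i \<bullet> row B i \<le> row A i \<bullet> row A i"
    "\<forall>i<n. \<forall>j<i. row B i \<bullet> row B j = 0"
    using orthogonalize_rows[OF A, of n] by auto
  let ?G = "B * transpose_mat B"
  have G: "?G \<in> carrier_mat n n" using B(1) by simp
  \<comment> \<open>Orthogonality for \<open>j < i\<close> gives the zeros below the diagonal, which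
    is enough to read off the determinant.\<close>
  have "upper_triangular ?G"
    using G B(1,4) mult_transpose_index[OF B(1)] by auto
  then have "det ?G = (\<Prod>i<n. row B i \<bullet> row B i)"
    using B(1) by (simp add: det_upper_triangular[OF _ G] prod_list_diag_prod atLeast0LessThan)
  moreover have "det ?G = (det A)\<^sup>2"
    using B(1,2) by (simp add: det_mult[of _ n] det_transpose power2_eq_square)
  moreover have "(\<Prod>i<n. row B i \<bullet> row B i) \<le> (\<Prod>i<n. row A i \<bullet> row A i)"
    using B(3) by (intro prod_mono) (auto simp: scalar_prod_self_nonneg)
  ultimately show ?thesis by simp
qed

text \<open>The last factor is the Gram determinant of rows \<open>i\<close> and \<open>j\<close>:
  the squared length of row \<open>i\<close> times that of the part of row \<open>j\<close>
  orthogonal to it.\<close>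

lemma Hadamard_inequality_two_rows:
  fixes A :: "real mat"
  assumes A: "A \<in> carrier_mat n n" and i: "i < n" and j: "j < n" and ij: "i \<noteq> j"
  shows "(det A)\<^sup>2 \<le> (\<Prod>k\<in>{..<n} - {i, j}. row A k \<bullet> row A k)
    * ((row A i \<bullet> row A i) * (row A j \<bullet> row A j) - (row A j \<bullet> row A i)\<^sup>2)"
proof -
  obtain B where B: "B \<in> carrier_mat n n" "det B = det A"
    "\<And>k. k < n \<Longrightarrow> k \<noteq> j \<Longrightarrow> row B k = row A k"
    "row B j \<bullet> row B j = row A j \<bullet> row A j - (row A j \<bullet> row A i)\<^sup>2 / (row A i \<bullet> row A i)"
    using subtract_row_projection[OF A i j ij] by metis
  \<comment> \<open>Needed to clear the denominator in \<open>B(4)\<close>: if row \<open>i\<close>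
    is zero, the quotient is 0 by convention and the squared inner product must be 0 as
    well.\<close>
  have degenerate: "row A j \<bullet> row A i = 0" if "row A i \<bullet> row A i = 0"
    using that scalar_prod_self_eq_0_imp[of "row A i" n "row A j"] A i j by simp
  have split: "{..<n} = insert i (insert j ({..<n} - {i, j}))" using i j by auto
  have "(det A)\<^sup>2 \<le> (\<Prod>k<n. row B k \<bullet> row B k)"
    using Hadamard_inequality[OF B(1)] B(2) by simp
  also have "\<dots> = (row B i \<bullet> row B i) * ((row B j \<bullet> row B j)
      * (\<Prod>k\<in>{..<n} - {i, j}. row B k \<bullet> row B k))"
    by (subst split) (use ij in simp)
  also have "(\<Prod>k\<in>{..<n} - {i, j}. row B k \<bullet> row B k)
      = (\<Prod>k\<in>{..<n} - {i, j}. row A k \<bullet> row A k)"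
    using B(3) by (intro prod.cong) auto
  also have "(row B i \<bullet> row B i) * ((row B j \<bullet> row B j) * p)
      = p * ((row A i \<bullet> row A i) * (row A j \<bullet> row A j) - (row A j \<bullet> row A i)\<^sup>2)" for p
  proof -
    have "(row A i \<bullet> row A i) * (row B j \<bullet> row B j)
        = (row A i \<bullet> row A i) * (row A j \<bullet> row A j) - (row A j \<bullet> row A i)\<^sup>2"
      using degenerate unfolding B(4) by (simp add: right_diff_distrib)
    then show ?thesis
      using B(3)[OF i ij] by (simp add: ac_simps)
  qed
  finally show ?thesis .
qed

lemma seidel_matrix_carrier: "seidel_matrix n T \<in> carrier_mat n n"
  by (simp add: seidel_matrix_def)

lemma seidel_matrix_row_norm:
  assumes "i < n"
  shows "row (seidel_matrix n T) i \<bullet> row (seidel_matrix n T) i = real n - 1"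
proof -
  have "row (seidel_matrix n T) i \<bullet> row (seidel_matrix n T) i
      = (\<Sum>k\<in>{0..<n}. if k = i then 0 else 1)"
    using assms unfolding scalar_prod_def by (intro sum.cong) (auto simp: seidel_matrix_def)
  also have "\<dots> = (\<Sum>k\<in>{0..<n} - {i}. 1)"
    using assms by (intro sum.mono_neutral_cong_right) auto
  finally show ?thesis using assms by simp
qed

lemma seidel_matrix_row_prod_even:
  assumes "i < n" "j < n" "i \<noteq> j" "even n"
  shows "\<exists>m::int. row (seidel_matrix n T) j \<bullet> row (seidel_matrix n T) i = 2 * of_int m"
proof -
  let ?S = "seidel_matrix n T"
  \<comment> \<open>\<open>c k\<close> records whether the two signs in column \<open>k\<close>
    agree, so that their product is \<open>2 * c k - 1\<close>. Columns \<open>i\<close> and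
    \<open>j\<close> contribute nothing because of the zero diagonal.\<close>
  define c :: "nat \<Rightarrow> int" where
    "c k = (if ?S $$ (j, k) = ?S $$ (i, k) then 1 else 0)" for k
  have "row ?S j \<bullet> row ?S i = (\<Sum>k\<in>{0..<n} - {i, j}. ?S $$ (j, k) * ?S $$ (i, k))"
    unfolding scalar_prod_def using assms
    by (intro sum.mono_neutral_cong_right) (auto simp: seidel_matrix_def)
  also have "\<dots> = (\<Sum>k\<in>{0..<n} - {i, j}. 2 * of_int (c k) - 1)"
    using assms by (intro sum.cong) (auto simp: seidel_matrix_def c_def)
  also have "\<dots> = 2 * of_int (\<Sum>k\<in>{0..<n} - {i, j}. c k) - real (n - 2)"
    using assms by (simp add: sum_subtractf sum_distrib_left card_Diff_subset)
  also have "real (n - 2) = 2 * of_int (int ((n - 2) div 2))"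
    using assms(4) by (simp add: real_of_nat_div)
  finally have "row ?S j \<bullet> row ?S i
      = 2 * of_int ((\<Sum>k\<in>{0..<n} - {i, j}. c k) - int ((n - 2) div 2))"
    by (simp add: algebra_simps)
  then show ?thesis by blast
qed

theorem theorem6p1:
  fixes n :: nat and T :: "nat pair_pre_digraph" and S :: "real mat"
  assumes "n > 0" and "even n"
    and "tournament n T" and "S = seidel_matrix n T"
  shows "skew_conference_matrix n S \<or>
    det S \<le> (real n - 1) ^ ((n - 2) div 2) * sqrt ((real n - 1)\<^sup>2 - 4)"
proof (cases "\<forall>i<n. \<forall>j<n. i \<noteq> j \<longrightarrow> row S j \<bullet> row S i = 0")
  case True
  have S: "S \<in> carrier_mat n n" using assms(4) seidel_matrix_carrier by simp
  have "S * transpose_mat S = (real n - 1) \<cdot>\<^sub>m 1\<^sub>m n"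
  proof (rule eq_matI)
    fix i j
    assume "i < dim_row ((real n - 1) \<cdot>\<^sub>m 1\<^sub>m n)" "j < dim_col ((real n - 1) \<cdot>\<^sub>m 1\<^sub>m n)"
    then have "i < n" "j < n" by auto
    then show "(S * transpose_mat S) $$ (i, j) = ((real n - 1) \<cdot>\<^sub>m 1\<^sub>m n) $$ (i, j)"
      using True S seidel_matrix_row_norm assms(4) by (cases "i = j") auto
  qed (use S in auto)
  moreover have "elements_mat S \<subseteq> {0, 1, - 1}"
    using assms(4) by (auto simp: elements_mat_def seidel_matrix_def)
  ultimately have "skew_conference_matrix n S"
    using S skew_symmetric_seidel_matrix[OF assms(3)] assms(4)
    by (simp add: skew_conference_matrix_def)
  then show ?thesis ..
next
  case False
  then obtain i j where ij: "i < n" "j < n" "i \<noteq> j" "row S j \<bullet> row S i \<noteq> 0" by blast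
  have S: "S \<in> carrier_mat n n" using assms(4) seidel_matrix_carrier by simp
  obtain m :: int where m: "row S j \<bullet> row S i = 2 * of_int m"
    using seidel_matrix_row_prod_even[OF ij(1-3) assms(2)] assms(4) by auto
  have "m \<noteq> 0" using m ij(4) by auto
  \<comment> \<open>A nonzero integer has square at least 1; this is where integrality turns a
    nonzero inner product into the gap of 4.\<close>
  then have "m\<^sup>2 \<ge> 1" by (simp add: int_one_le_iff_zero_less)
  then have "real_of_int (m\<^sup>2) \<ge> 1" by linarith
  then have g: "(row S j \<bullet> row S i)\<^sup>2 \<ge> 4" by (simp add: m power_mult_distrib)
  have "(det S)\<^sup>2 \<le> (\<Prod>k\<in>{..<n} - {i, j}. row S k \<bullet> row S k)
      * ((row S i \<bullet> row S i) * (row S j \<bullet> row S j) - (row S j \<bullet> row S i)\<^sup>2)"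
    by (rule Hadamard_inequality_two_rows[OF S ij(1-3)])
  also have "\<dots> = (real n - 1) ^ (n - 2) * ((real n - 1)\<^sup>2 - (row S j \<bullet> row S i)\<^sup>2)"
    using ij assms(4) by (simp add: seidel_matrix_row_norm card_Diff_subset power2_eq_square
        numeral_2_eq_2)
  also have "\<dots> \<le> (real n - 1) ^ (n - 2) * ((real n - 1)\<^sup>2 - 4)"
    using g assms(1) by (intro mult_left_mono) auto
  \<comment> \<open>Since \<open>n\<close> is even, this power is a perfect square and leaves the
    root with exponent \<open>(n - 2) div 2\<close>.\<close>
  also have "(real n - 1) ^ (n - 2) = ((real n - 1) ^ ((n - 2) div 2))\<^sup>2"
    using assms(2) by (simp flip: power_mult)
  finally have "sqrt ((det S)\<^sup>2)
      \<le> sqrt (((real n - 1) ^ ((n - 2) div 2))\<^sup>2 * ((real n - 1)\<^sup>2 - 4))"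
    by (rule real_sqrt_le_mono)
  \<comment> \<open>The root of the squared determinant is its absolute value, which bounds
    \<open>det S\<close>; the base \<open>real n - 1\<close> is nonnegative because
    \<open>n > 0\<close>.\<close>
  then have "det S \<le> (real n - 1) ^ ((n - 2) div 2) * sqrt ((real n - 1)\<^sup>2 - 4)"
    using assms(1) by (simp add: real_sqrt_mult)
  then show ?thesis ..
qed

end
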